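(* Let $\Psi:\mathbb{R}\to(0,\infty)$ be a bounded, nondecreasing $\mathcal{C}^2$ function with $\Psi(0)=\Psi'(0)=1$, and let $\Psi(\infty)=\lim_{x\to\infty}\Psi(x)$. For $(u_0,v_0)\in[0,\infty)\times\mathbb{R}$ let $(u_n,v_n)_{n\ge0}$ be given by $v_{n+1}=u_n+v_n$, $u_{n+1}=u_n\Psi(v_{n+1})$, and let $F(u_0,v_0):=\liminf_{n\to\infty}\Psi(\infty)^{-n}u_n$. Then $$F(u_0,v_0)=\lim_{n\to\infty}\Psi(\infty)^{-n}u_n=\inf_{n\in\mathbb{N}}\Psi(\infty)^{-n}u_n.$$ Furthermore, if $$\sum_{j=1}^\infty\big(\Psi(\infty)-\Psi(\kappa^j)\big)<\infty\quad\text{for all }\kappa>1,$$ then for every $(u_0,v_0)\in[0,\infty)\times\mathbb{R}$, $$\lim_{n\to\infty}v_n=\infty\iff F(u_0,v_0)>0.$$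
   Context: $\mathbb{N}$ denotes the positive integers. The set of initial conditions with $\lim_n v_n=\infty$ is called the supercritical domain, and $F$ is called the free energy of the recursion. *)

theory Defs
  imports "HOL-Analysis.Analysis"
begin

definition C2 :: "(real \<Rightarrow> real) \<Rightarrow> bool" where
  "C2 f \<longleftrightarrow> f differentiable_on UNIV \<and> deriv f differentiable_on UNIV \<and>
     continuous_on UNIV (deriv (deriv f))"

text \<open>Only meaningful when the limit exists, as it does for bounded monotone \<open>\<Psi>\<close>.\<close>

definition lim_infty :: "(real \<Rightarrow> real) \<Rightarrow> real" where
  "lim_infty \<Psi> = Lim at_top \<Psi>"

primrec orbit :: "(real \<Rightarrow> real) \<Rightarrow> real \<Rightarrow> real \<Rightarrow> nat \<Rightarrow> real \<times> real" where
  "orbit \<Psi> u0 v0 0 = (u0, v0)"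
| "orbit \<Psi> u0 v0 (Suc n) =
     (let (u, v) = orbit \<Psi> u0 v0 n; v' = u + v in (u * \<Psi> v', v'))"

definition u_seq :: "(real \<Rightarrow> real) \<Rightarrow> real \<Rightarrow> real \<Rightarrow> nat \<Rightarrow> real" where
  "u_seq \<Psi> u0 v0 n = fst (orbit \<Psi> u0 v0 n)"

definition v_seq :: "(real \<Rightarrow> real) \<Rightarrow> real \<Rightarrow> real \<Rightarrow> nat \<Rightarrow> real" where
  "v_seq \<Psi> u0 v0 n = snd (orbit \<Psi> u0 v0 n)"

lemma u_seq_0: "u_seq \<Psi> u0 v0 0 = u0"
  and v_seq_0: "v_seq \<Psi> u0 v0 0 = v0"
  and v_seq_Suc: "v_seq \<Psi> u0 v0 (Suc n) = u_seq \<Psi> u0 v0 n + v_seq \<Psi> u0 v0 n"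
  and u_seq_Suc: "u_seq \<Psi> u0 v0 (Suc n) = u_seq \<Psi> u0 v0 n * \<Psi> (v_seq \<Psi> u0 v0 (Suc n))"
  by (simp_all add: u_seq_def v_seq_def Let_def case_prod_beta)

definition normalized_u :: "(real \<Rightarrow> real) \<Rightarrow> real \<Rightarrow> real \<Rightarrow> nat \<Rightarrow> real" where
  "normalized_u \<Psi> u0 v0 n = u_seq \<Psi> u0 v0 n / lim_infty \<Psi> ^ n"

text \<open>The free energy is valued in the extended reals, since a limit inferior of reals need
  not be finite a priori and \<open>liminf\<close> requires a complete lattice.\<close>

definition free_energy :: "(real \<Rightarrow> real) \<Rightarrow> real \<Rightarrow> real \<Rightarrow> ereal" where
  "free_energy \<Psi> u0 v0 = liminf (\<lambda>n. ereal (normalized_u \<Psi> u0 v0 n))"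

end

theory Submission
  imports Defs
begin

text \<open>
  Write \<open>L = \<Psi>(\<infinity>)\<close> and \<open>w n = u n / L ^ n\<close>. Each step multiplies \<open>w\<close> by \<open>\<Psi>(v (n + 1)) / L \<le> 1\<close>,
  so \<open>w\<close> is decreasing, which identifies its liminf, its limit and its infimum.

  If the free energy \<open>F\<close> is positive, then \<open>u n \<ge> w n \<ge> F\<close> because \<open>L \<ge> 1\<close>, and \<open>v\<close>, whose
  increments are the \<open>u n\<close>, grows at least linearly. Conversely, let \<open>v\<close> tend to infinity.
  Then \<open>u\<close> is positive, since \<open>v\<close> is constant for \<open>u 0 = 0\<close>. Eventually \<open>v n \<ge> 1\<close>, so \<open>u\<close> is
  from then on multiplied by at least \<open>\<Psi>(1) > 1\<close> in each step; hence \<open>u\<close> and with it \<open>v\<close> grow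
  exponentially, and \<open>v n \<ge> \<kappa> ^ n\<close> eventually for some \<open>\<kappa> > 1\<close>. The
  summability hypothesis for this \<open>\<kappa>\<close> makes the relative losses \<open>1 - \<Psi>(v n) / L\<close> summable, and a
  positive sequence whose relative losses are summable cannot decrease to zero.
  The strict bound \<open>\<Psi>(1) > 1\<close> comes from \<open>\<Psi>(0) = 1\<close>, \<open>\<Psi>'(0) > 0\<close> and monotonicity.
\<close>

lemma mono_bounded_tendsto_lim_infty:
  fixes f :: "real \<Rightarrow> real"
  assumes "mono f" "bounded (range f)"
  shows "(f \<longlongrightarrow> lim_infty f) at_top"
proof -
  have bdd: "bdd_above (range f)"
    using assms(2) by (rule bounded_imp_bdd_above)
  have "(f \<longlongrightarrow> (SUP x. f x)) at_top"
  proof (rule order_tendstoI)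
    fix a assume "a < (SUP x. f x)"
    then obtain x where "a < f x"
      using less_cSUP_iff[OF _ bdd] by auto
    then have "a < f y" if "y \<ge> x" for y
      using monoD[OF assms(1) that] by linarith
    then show "\<forall>\<^sub>F y in at_top. a < f y"
      using eventually_at_top_linorder by blast
  next
    fix a assume a: "(SUP x. f x) < a"
    have "f y < a" for y
      using cSUP_upper[OF UNIV_I bdd, of y] a by linarith
    then show "\<forall>\<^sub>F y in at_top. f y < a" by simp
  qed
  then show ?thesis
    unfolding lim_infty_def using tendsto_Lim[OF trivial_limit_at_top_linorder] by metis
qed

lemma mono_greater_right_of_positive_deriv:
  fixes f :: "real \<Rightarrow> real"
  assumes "mono f" "f differentiable (at a)" "deriv f a > 0" "a < x"
  shows "f a < f x"
proof -
  have "(f has_real_derivative deriv f a) (at a)"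
    using assms(2) by (simp add: DERIV_deriv_iff_real_differentiable)
  then obtain d where d: "d > 0" "\<And>h. h > 0 \<Longrightarrow> h < d \<Longrightarrow> f a < f (a + h)"
    using DERIV_pos_inc_right[OF _ assms(3)] by blast
  define h where "h = min (d / 2) (x - a)"
  have "h > 0" "h < d" "a + h \<le> x"
    using d(1) assms(4) by (auto simp: h_def)
  then show ?thesis
    using d(2)[of h] monoD[OF assms(1), of "a + h" x] by linarith
qed

text \<open>
  Since \<open>w\<close> decreases, the loss in each step is at most \<open>a n * w M\<close> for any
  fixed earlier index \<open>M\<close>. Taking \<open>M\<close> so late that the tail of \<open>a\<close> sums to less than
  \<open>1 / 2\<close>, the total loss after \<open>M\<close> is less than half of \<open>w M\<close>.
\<close>
lemma decreasing_bounded_below_of_summable_losses: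
  fixes w a :: "nat \<Rightarrow> real"
  assumes pos: "\<And>n. w n > 0" and dec: "decseq w"
    and a: "summable a" "\<And>n. a n \<ge> 0"
    and step: "\<And>n. w (Suc n) = w n * (1 - a n)"
  shows "\<exists>c>0. \<forall>n. w n \<ge> c"
proof -
  obtain M where "norm (\<Sum>k. a (k + M)) < 1 / 2"
    using suminf_exist_split[of "1 / 2", OF _ a(1)] by auto
  then have M: "(\<Sum>k. a (k + M)) < 1 / 2" by simp
  have tail: "(\<Sum>k<m. a (k + M)) \<le> 1 / 2" for m
    using sum_le_suminf[OF summable_ignore_initial_segment[OF a(1)], of "{..<m}" M] a(2) M
    by fastforce
  have loss: "w (m + M) \<ge> w M * (1 - (\<Sum>k<m. a (k + M)))" for m
  proof (induction m)
    case (Suc m)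
    have "w (m + M) * a (m + M) \<le> w M * a (m + M)"
      using decseqD[OF dec, of M "m + M"] a(2) by (intro mult_right_mono) auto
    then show ?case
      using Suc step[of "m + M"] by (simp add: algebra_simps)
  qed simp
  have "w n \<ge> w M / 2" for n
  proof -
    have "w n \<ge> w (n + M)"
      using decseqD[OF dec] by simp
    moreover have "w M * (1 / 2) \<le> w M * (1 - (\<Sum>k<n. a (k + M)))"
      using pos[of M] tail[of n] by (intro mult_left_mono) auto
    ultimately show ?thesis
      using loss[of n] by linarith
  qed
  then show ?thesis
    using pos[of M] by (intro exI[of _ "w M / 2"]) auto
qed

locale monotone_recursion =
  fixes \<Psi> :: "real \<Rightarrow> real"
  assumes \<Psi>_pos: "\<Psi> x > 0"
    and \<Psi>_bounded: "bounded (range \<Psi>)"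
    and \<Psi>_mono: "mono \<Psi>"
begin

lemma \<Psi>_le_lim_infty: "\<Psi> x \<le> lim_infty \<Psi>"
proof (rule tendsto_lowerbound)
  show "(\<Psi> \<longlongrightarrow> lim_infty \<Psi>) at_top"
    using \<Psi>_mono \<Psi>_bounded by (rule mono_bounded_tendsto_lim_infty)
  show "\<forall>\<^sub>F y in at_top. \<Psi> x \<le> \<Psi> y"
    using eventually_ge_at_top[of x] by eventually_elim (rule monoD[OF \<Psi>_mono])
qed simp

lemma lim_infty_pos: "lim_infty \<Psi> > 0"
  using \<Psi>_pos[of 0] \<Psi>_le_lim_infty[of 0] by linarith

lemma u_seq_nonneg: "u0 \<ge> 0 \<Longrightarrow> u_seq \<Psi> u0 v0 n \<ge> 0"
  by (induction n) (simp_all add: u_seq_0 u_seq_Suc less_imp_le \<Psi>_pos)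

lemma u_seq_pos: "u0 > 0 \<Longrightarrow> u_seq \<Psi> u0 v0 n > 0"
  by (induction n) (simp_all add: u_seq_0 u_seq_Suc \<Psi>_pos)

lemma normalized_u_nonneg: "u0 \<ge> 0 \<Longrightarrow> normalized_u \<Psi> u0 v0 n \<ge> 0"
  using u_seq_nonneg lim_infty_pos by (simp add: normalized_u_def)

lemma normalized_u_Suc:
  "normalized_u \<Psi> u0 v0 (Suc n) =
     normalized_u \<Psi> u0 v0 n * (\<Psi> (v_seq \<Psi> u0 v0 (Suc n)) / lim_infty \<Psi>)"
  by (simp add: normalized_u_def u_seq_Suc)

lemma normalized_u_decseq:
  assumes "u0 \<ge> 0"
  shows "decseq (normalized_u \<Psi> u0 v0)"
proof (rule decseq_SucI)
  fix n
  have "\<Psi> (v_seq \<Psi> u0 v0 (Suc n)) / lim_infty \<Psi> \<le> 1"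
    using \<Psi>_le_lim_infty lim_infty_pos by simp
  then show "normalized_u \<Psi> u0 v0 (Suc n) \<le> normalized_u \<Psi> u0 v0 n"
    unfolding normalized_u_Suc using normalized_u_nonneg[OF assms] by (rule mult_left_le)
qed

lemma normalized_u_tendsto_free_energy:
  assumes "u0 \<ge> 0"
  shows "(\<lambda>n. ereal (normalized_u \<Psi> u0 v0 n)) \<longlonglongrightarrow> free_energy \<Psi> u0 v0" (is ?lim)
    and "free_energy \<Psi> u0 v0 = (INF n\<in>{1..}. ereal (normalized_u \<Psi> u0 v0 n))" (is ?inf)
proof -
  let ?w = "\<lambda>n. ereal (normalized_u \<Psi> u0 v0 n)"
  have dec: "decseq ?w"
    using normalized_u_decseq[OF assms] by (simp add: decseq_def)
  show lim: ?lim
    using LIMSEQ_INF[OF dec] lim_imp_Liminf[OF sequentially_bot]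
    unfolding free_energy_def by metis
  have "(\<lambda>n. ?w (Suc n)) \<longlonglongrightarrow> (INF n. ?w (Suc n))"
    using dec by (intro LIMSEQ_INF) (simp add: decseq_def)
  then have "free_energy \<Psi> u0 v0 = (INF n. ?w (Suc n))"
    using LIMSEQ_Suc[OF lim] LIMSEQ_unique by blast
  also have "(\<lambda>n. ?w (Suc n)) ` UNIV = ?w ` {1..}"
    by (auto simp: image_iff) (metis Suc_le_D)
  finally show ?inf .
qed

lemma free_energy_le_normalized_u:
  assumes "u0 \<ge> 0"
  shows "free_energy \<Psi> u0 v0 \<le> ereal (normalized_u \<Psi> u0 v0 n)"
proof (rule LIMSEQ_le_const2)
  show "\<exists>N. \<forall>m\<ge>N. ereal (normalized_u \<Psi> u0 v0 m) \<le> ereal (normalized_u \<Psi> u0 v0 n)"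
    using decseqD[OF normalized_u_decseq[OF assms]] by auto
qed (rule normalized_u_tendsto_free_energy(1)[OF assms])

lemma v_seq_at_top_if_free_energy_pos:
  assumes "u0 \<ge> 0" "lim_infty \<Psi> \<ge> 1" "free_energy \<Psi> u0 v0 > 0"
  shows "filterlim (v_seq \<Psi> u0 v0) at_top sequentially"
proof -
  obtain c where c: "c > 0" "ereal c < free_energy \<Psi> u0 v0"
    using ereal_dense2[OF assms(3)] by auto
  have u_ge: "c \<le> u_seq \<Psi> u0 v0 n" for n
  proof -
    have "ereal c < ereal (normalized_u \<Psi> u0 v0 n)"
      using c(2) free_energy_le_normalized_u[OF assms(1)] by (rule less_le_trans)
    then have "c < normalized_u \<Psi> u0 v0 n" by simp
    also have "\<dots> \<le> u_seq \<Psi> u0 v0 n"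
      using mult_left_mono[OF one_le_power[OF assms(2), of n] u_seq_nonneg[OF assms(1), of v0 n]]
        lim_infty_pos
      by (simp add: normalized_u_def divide_le_eq)
    finally show ?thesis by simp
  qed
  have "v_seq \<Psi> u0 v0 n \<ge> v0 + real n * c" for n
  proof (induction n)
    case (Suc n)
    then show ?case using u_ge[of n] by (simp add: v_seq_Suc algebra_simps)
  qed (simp add: v_seq_0)
  moreover have "filterlim (\<lambda>n. v0 + real n * c) at_top sequentially"
    using c(1) by real_asymp
  ultimately show ?thesis
    by (intro filterlim_at_top_mono[of _ _ "v_seq \<Psi> u0 v0"] always_eventually) auto
qed

text \<open>
  Past the level \<open>1\<close> the growth factor of \<open>u\<close> is at least \<open>q = \<Psi> 1 > 1\<close>, so
  \<open>v (n + 1) \<ge> u n\<close> exceeds a fixed multiple of \<open>q ^ n\<close>. Passing to the smaller rate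
  \<open>sqrt q\<close> absorbs the unknown multiplicative constant.
\<close>
lemma v_seq_eventually_exponential:
  assumes "u0 > 0" "\<Psi> 1 > 1" "filterlim (v_seq \<Psi> u0 v0) at_top sequentially"
  shows "\<exists>\<kappa>>1. \<forall>\<^sub>F n in sequentially. \<kappa> ^ Suc n \<le> v_seq \<Psi> u0 v0 (Suc n)"
proof -
  define q where "q = \<Psi> 1"
  have q: "q > 1" using assms(2) by (simp add: q_def)
  obtain N where N: "\<And>n. n \<ge> N \<Longrightarrow> v_seq \<Psi> u0 v0 n \<ge> 1"
    using assms(3) unfolding filterlim_at_top eventually_sequentially by blast
  define c where "c = u_seq \<Psi> u0 v0 N / q ^ N"
  have c: "c > 0" using u_seq_pos[OF assms(1)] q by (simp add: c_def)
  have u_ge: "c * q ^ n \<le> u_seq \<Psi> u0 v0 n" if "n \<ge> N" for n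
    using that
  proof (induction n rule: dec_induct)
    case base
    then show ?case using q by (simp add: c_def)
  next
    case (step n)
    have "q \<le> \<Psi> (v_seq \<Psi> u0 v0 (Suc n))"
      unfolding q_def using N[of "Suc n"] step(1) by (intro monoD[OF \<Psi>_mono]) simp
    then have "(c * q ^ n) * q \<le> u_seq \<Psi> u0 v0 n * \<Psi> (v_seq \<Psi> u0 v0 (Suc n))"
      using step(3) q c u_seq_pos[OF assms(1), of v0 n] by (intro mult_mono) auto
    then show ?case by (simp add: u_seq_Suc mult_ac)
  qed
  define \<kappa> where "\<kappa> = sqrt q"
  have \<kappa>: "\<kappa> > 1" "\<kappa> * \<kappa> = q" using q by (simp_all add: \<kappa>_def)
  have "filterlim (\<lambda>n. \<kappa> ^ n) at_top sequentially"
    using \<kappa>(1) by real_asymp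
  then have "\<forall>\<^sub>F n in sequentially. \<kappa> ^ n \<ge> \<kappa> / c"
    by (simp add: filterlim_at_top)
  then have "\<forall>\<^sub>F n in sequentially. \<kappa> ^ Suc n \<le> v_seq \<Psi> u0 v0 (Suc n)"
    using eventually_ge_at_top[of N]
  proof eventually_elim
    case (elim n)
    have "\<kappa> ^ Suc n \<le> (c * \<kappa> ^ n) * \<kappa> ^ n"
      using elim(1) c \<kappa>(1) by (simp add: field_simps)
    also have "\<dots> = c * q ^ n"
      by (simp add: \<kappa>(2)[symmetric] power_mult_distrib)
    also have "\<dots> \<le> u_seq \<Psi> u0 v0 n"
      using elim(2) by (rule u_ge)
    also have "\<dots> \<le> v_seq \<Psi> u0 v0 (Suc n)"
      using N[OF elim(2)] by (simp add: v_seq_Suc)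
    finally show ?case .
  qed
  with \<kappa>(1) show ?thesis by blast
qed

lemma free_energy_pos_if_v_seq_at_top:
  assumes "u0 \<ge> 0" "\<Psi> 1 > 1" "filterlim (v_seq \<Psi> u0 v0) at_top sequentially"
    and summable: "\<And>\<kappa>. \<kappa> > 1 \<Longrightarrow> summable (\<lambda>j. lim_infty \<Psi> - \<Psi> (\<kappa> ^ Suc j))"
  shows "free_energy \<Psi> u0 v0 > 0"
proof -
  let ?L = "lim_infty \<Psi>" and ?v = "v_seq \<Psi> u0 v0" and ?w = "normalized_u \<Psi> u0 v0"
  have "u0 > 0"
  proof (rule ccontr)
    assume "\<not> u0 > 0"
    then have "u0 = 0" using assms(1) by simp
    then have u: "u_seq \<Psi> u0 v0 n = 0" for n
      by (induction n) (simp_all add: u_seq_0 u_seq_Suc)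
    have "?v n = v0" for n
      by (induction n) (simp_all add: v_seq_0 v_seq_Suc u)
    then have "?v = (\<lambda>_. v0)" by auto
    then show False
      using assms(3) by (auto simp: filterlim_at_top_dense eventually_sequentially)
  qed
  define a where "a n = (?L - \<Psi> (?v (Suc n))) / ?L" for n
  have a_nonneg: "a n \<ge> 0" for n
    using \<Psi>_le_lim_infty lim_infty_pos by (simp add: a_def)
  obtain \<kappa> where \<kappa>: "\<kappa> > 1" "\<forall>\<^sub>F n in sequentially. \<kappa> ^ Suc n \<le> ?v (Suc n)"
    using v_seq_eventually_exponential[OF \<open>u0 > 0\<close> assms(2,3)] by blast
  have "summable (\<lambda>n. ?L - \<Psi> (?v (Suc n)))"
  proof (rule summable_comparison_test_ev[OF _ summable[OF \<kappa>(1)]])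
    show "\<forall>\<^sub>F n in sequentially. norm (?L - \<Psi> (?v (Suc n))) \<le> ?L - \<Psi> (\<kappa> ^ Suc n)"
      using \<kappa>(2)
    proof eventually_elim
      case (elim n)
      then show ?case
        using monoD[OF \<Psi>_mono elim] \<Psi>_le_lim_infty[of "?v (Suc n)"] by simp
    qed
  qed
  then have "summable a"
    unfolding a_def by (rule summable_divide)
  moreover have "?w (Suc n) = ?w n * (1 - a n)" for n
    using lim_infty_pos by (simp add: normalized_u_Suc a_def diff_divide_distrib)
  moreover have "?w n > 0" for n
    using u_seq_pos[OF \<open>u0 > 0\<close>] lim_infty_pos by (simp add: normalized_u_def)
  ultimately obtain c where c: "c > 0" "\<And>n. ?w n \<ge> c"
    using decreasing_bounded_below_of_summable_losses[OF _ normalized_u_decseq[OF assms(1)], of v0 a]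
      a_nonneg by blast
  have "ereal c \<le> free_energy \<Psi> u0 v0"
    using normalized_u_tendsto_free_energy(1)[OF assms(1)] by (rule LIMSEQ_le_const) (simp add: c(2))
  moreover have "0 < ereal c" using c(1) by simp
  ultimately show ?thesis by (metis less_le_trans)
qed

end

theorem proposition1p2:
  fixes \<Psi> :: "real \<Rightarrow> real"
  assumes "\<forall>x. \<Psi> x > 0"
    and "bounded (range \<Psi>)"
    and "mono \<Psi>"
    and "C2 \<Psi>"
    and "\<Psi> 0 = 1"
    and "deriv \<Psi> 0 = 1"
  shows "(\<forall>u0 v0. u0 \<ge> 0 \<longrightarrow>
            (\<lambda>n. ereal (normalized_u \<Psi> u0 v0 n)) \<longlonglongrightarrow> free_energy \<Psi> u0 v0 \<and>
            free_energy \<Psi> u0 v0 = (INF n\<in>{1..}. ereal (normalized_u \<Psi> u0 v0 n))) \<and>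
         ((\<forall>\<kappa>>1. summable (\<lambda>j. lim_infty \<Psi> - \<Psi> (\<kappa> ^ Suc j))) \<longrightarrow>
           (\<forall>u0 v0. u0 \<ge> 0 \<longrightarrow>
              (filterlim (v_seq \<Psi> u0 v0) at_top sequentially \<longleftrightarrow> free_energy \<Psi> u0 v0 > 0)))"
proof -
  interpret monotone_recursion \<Psi>
    using assms(1-3) by unfold_locales auto
  have "\<Psi> differentiable (at 0)"
    using assms(4) by (auto simp: C2_def differentiable_on_def)
  then have \<Psi>_1: "\<Psi> 1 > 1"
    using mono_greater_right_of_positive_deriv[OF assms(3), of 0 1] assms(5,6) by simp
  have L: "lim_infty \<Psi> \<ge> 1"
    using \<Psi>_le_lim_infty[of 0] assms(5) by simp
  show ?thesis
    using normalized_u_tendsto_free_energy v_seq_at_top_if_free_energy_pos[OF _ L]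
      free_energy_pos_if_v_seq_at_top[OF _ \<Psi>_1]
    by blast
qed

end
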